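(* Simple $3$-$(20,5,2m)$ designs exist for $m\in\{2,7\}$, i.e. simple $3$-$(20,5,4)$ and $3$-$(20,5,14)$ designs exist.
   Context: A $t$-$(v,k,\lambda)$ design consists of a $v$-element set $P$ of points together with a collection $B$ of $k$-element subsets of $P$ (called blocks) such that every $t$-element subset of $P$ is contained in exactly $\lambda$ blocks. The design is simple if $B$ is a set, i.e. contains no repeated blocks. *)

theory Defs
  imports Main "HOL-Library.Multiset"
begin

text \<open>Blocks form a multiset, so that repeated blocks are possible and simplicity is a
  genuine condition.\<close>

definition t_design :: "nat \<Rightarrow> nat \<Rightarrow> nat \<Rightarrow> nat \<Rightarrow> 'a set \<Rightarrow> 'a set multiset \<Rightarrow> bool" where
  "t_design t v k l P B \<longleftrightarrow>
     finite P \<and> card P = v \<and>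
     (\<forall>b. b \<in># B \<longrightarrow> b \<subseteq> P \<and> card b = k) \<and>
     (\<forall>T. T \<subseteq> P \<and> card T = t \<longrightarrow> size {#b \<in># B. T \<subseteq> b#} = l)"

definition simple_blocks :: "'a set multiset \<Rightarrow> bool" where
  "simple_blocks B \<longleftrightarrow> (\<forall>b. count B b \<le> 1)"

end

theory Submission
  imports Defs "HOL-Library.Nat_Bijection" "HOL-Library.Code_Binary_Nat"
begin

text \<open>Both designs live on the integers modulo 19 together with a fixed point, written as 19, and
  consist of all translates of a list of base blocks. Every triple can be translated to a triple
  through 0, and the blocks through 0 are the translates of a base block \<open>b\<close> by \<open>- p\<close>, for \<open>p\<close> in
  \<open>b\<close> different from 19. So it suffices to check that these translates are pairwise different and
  that each pair of nonzero points lies in \<open>\<lambda>\<close> of them.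

  The base blocks were found by a computer search, a simulated annealing for the Kramer-Mesner
  system of the dihedral group of order 38 generated by \<open>x \<mapsto> x + 1\<close> and \<open>x \<mapsto> - x\<close>.\<close>

section \<open>Translations and the sets of blocks they generate\<close>

definition shift :: "nat \<Rightarrow> nat \<Rightarrow> nat \<Rightarrow> nat" where
  "shift n i x = (if x < n then (x + i) mod n else x)"

text \<open>As a set it merges coinciding translates, so its multiset is simple by construction. All
  of the difficulty lies in counting its members correctly.\<close>

definition development :: "nat \<Rightarrow> nat list list \<Rightarrow> nat set set" where
  "development n D = (\<Union>i<n. (\<lambda>b. shift n i ` set b) ` set D)"

text \<open>Kept as a list, with repetitions, so that distinctness can be tested and cardinalities
  computed as lengths. The translation by -p is written as the natural number
  \<open>n - p\<close>.\<close>

definition blocks_through_zero :: "nat \<Rightarrow> nat list list \<Rightarrow> nat list list" where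
  "blocks_through_zero n D =
     concat (map (\<lambda>b. map (\<lambda>p. map (shift n (n - p)) b) (filter (\<lambda>p. p < n) b)) D)"

lemma shift_mod: "0 < n \<Longrightarrow> shift n (i mod n) x = shift n i x"
  by (simp add: shift_def mod_add_right_eq)

lemma shift_shift: "shift n i (shift n j x) = shift n (j + i) x"
  by (auto simp: shift_def mod_add_left_eq add.assoc)

lemma shift_period: "shift n n x = x"
  by (simp add: shift_def)

lemma shift_le: "x \<le> n \<Longrightarrow> shift n i x \<le> n"
  by (auto simp: shift_def intro: less_imp_le)

lemma inj_shift:
  assumes "i \<le> n"
  shows "inj (shift n i)"
  by (rule inj_on_inverseI[where g = "shift n (n - i)"]) (simp add: shift_shift shift_period assms)

lemma shift_developmentI:
  assumes "0 < n" "b \<in> set D"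
  shows "shift n i ` set b \<in> development n D"
proof -
  have "shift n i ` set b = shift n (i mod n) ` set b"
    using assms by (simp add: shift_mod)
  also have "\<dots> \<in> development n D"
    unfolding development_def using assms by (intro UN_I[of "i mod n"] imageI) simp_all
  finally show ?thesis .
qed

lemma development_shift_closed:
  assumes "X \<in> development n D"
  shows "shift n j ` X \<in> development n D"
proof -
  obtain i b where "i < n" "b \<in> set D" and X: "X = shift n i ` set b"
    using assms by (auto simp: development_def)
  then show ?thesis
    using shift_developmentI[of n b D "i + j"] by (simp add: X image_image shift_shift)
qed

lemma finite_development: "finite (development n D)"
  by (simp add: development_def)

text \<open>Translation by j permutes the development, with inverse translation by
  \<open>n - j\<close>, and carries blocks containing T to blocks containing the translate of
  T.\<close>

lemma card_development_containing_shift: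
  assumes "j \<le> n"
  shows "card {X \<in> development n D. shift n j ` T \<subseteq> X} = card {X \<in> development n D. T \<subseteq> X}"
proof -
  have inv: "shift n (n - j) ` shift n j ` X = X" "shift n j ` shift n (n - j) ` X = X" for X
    using assms by (simp_all add: image_image shift_shift shift_period)
  have "bij_betw (\<lambda>X. shift n j ` X) {X \<in> development n D. T \<subseteq> X}
      {X \<in> development n D. shift n j ` T \<subseteq> X}"
  proof (rule bij_betw_byWitness[where f' = "\<lambda>X. shift n (n - j) ` X"])
    have "T \<subseteq> shift n (n - j) ` X" if "shift n j ` T \<subseteq> X" for X
      using image_mono[OF that, of "shift n (n - j)"] by (simp only: inv)
    then show "(\<lambda>X. shift n (n - j) ` X) ` {X \<in> development n D. shift n j ` T \<subseteq> X}
        \<subseteq> {X \<in> development n D. T \<subseteq> X}"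
      by (auto intro: development_shift_closed)
  qed (use inv in \<open>auto intro: development_shift_closed\<close>)
  from bij_betw_same_card[OF this] show ?thesis
    by simp
qed

section \<open>Blocks through 0 and the design criterion\<close>

lemma development_containing_zero:
  assumes "0 < n"
  shows "{X \<in> development n D. 0 \<in> X} = set (map set (blocks_through_zero n D))"
proof (rule set_eqI, rule iffI)
  fix X
  assume "X \<in> {X \<in> development n D. 0 \<in> X}"
  then obtain i b p where i: "i < n" and b: "b \<in> set D" and p: "p \<in> set b"
    and X: "X = shift n i ` set b" and 0: "shift n i p = 0"
    by (auto simp: development_def)
  from 0 assms have "p < n" and "(p + i) mod n = 0"
    by (auto simp: shift_def split: if_splits)
  \<comment> \<open>Both sides represent -p modulo n. Since p + i < 2n, the sum is 0 or n; if it is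
    0, then \<open>n - p\<close> is n itself, hence the reduction modulo n.\<close>
  have "(n - p) mod n = i mod n"
  proof (cases "p + i = 0")
    case False
    have "n dvd p + i" using \<open>(p + i) mod n = 0\<close> by auto
    then obtain k where "p + i = n * k" by blast
    moreover from this False have "k \<noteq> 0" by auto
    moreover have "p + i < n * 2" using \<open>p < n\<close> i by simp
    ultimately have "k = 1" by (metis One_nat_def less_2_cases mult_less_cancel1)
    then show ?thesis using \<open>p + i = n * k\<close> by (metis diff_add_inverse mult.right_neutral)
  qed simp
  then have "X = shift n (n - p) ` set b"
    unfolding X using shift_mod[OF assms] by (metis (mono_tags, lifting) image_cong)
  then show "X \<in> set (map set (blocks_through_zero n D))"
    using b p \<open>p < n\<close> by (auto simp: blocks_through_zero_def image_iff intro!: bexI)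
next
  fix X
  assume "X \<in> set (map set (blocks_through_zero n D))"
  then obtain b p where b: "b \<in> set D" "p \<in> set b" "p < n" and X: "X = shift n (n - p) ` set b"
    by (auto simp: blocks_through_zero_def)
  have "shift n (n - p) p = 0"
    using b by (simp add: shift_def)
  then have "0 \<in> X"
    using b by (force simp: X)
  then show "X \<in> {X \<in> development n D. 0 \<in> X}"
    using shift_developmentI[OF assms b(1)] by (simp add: X)
qed

lemma t_design_development:
  assumes base: "\<And>b. b \<in> set D \<Longrightarrow> distinct b \<and> length b = k \<and> set b \<subseteq> {..n}"
    and dist: "distinct (map set (blocks_through_zero n D))"
    and count: "\<And>a c. 0 < a \<Longrightarrow> a < c \<Longrightarrow> c \<le> n \<Longrightarrow>
      length (filter (\<lambda>q. a \<in> set q \<and> c \<in> set q) (blocks_through_zero n D)) = l"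
  shows "t_design 3 (Suc n) k l {..n} (mset_set (development n D))"
proof -
  let ?A = "development n D"
  have blocks: "X \<subseteq> {..n} \<and> card X = k" if X_in: "X \<in> ?A" for X
  proof -
    obtain i b where i: "i < n" and b: "b \<in> set D" and X: "X = shift n i ` set b"
      using X_in by (auto simp: development_def)
    have "card X = card (set b)"
      unfolding X using i by (intro card_image inj_on_subset[OF inj_shift]) auto
    then show ?thesis
      using base[OF b] by (auto simp: X distinct_card intro: shift_le)
  qed
  have triple: "card {X \<in> ?A. T \<subseteq> X} = l" if T: "T \<subseteq> {..n}" "card T = 3" for T
  proof -
    \<comment> \<open>Not all points of a triple are equal to the fixed point \<^term>\<open>n\<close>, hence the triple can be
      shifted to one through 0.\<close>
    have "\<not> T \<subseteq> {n}"
      using T(2) card_mono[of "{n}" T] by auto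
    then obtain p where p: "p \<in> T" "p < n"
      using T(1) by (metis atMost_iff insertI1 nat_less_le subsetD subsetI)
    define S where "S = shift n (n - p) ` T"
    have "0 < n" using p by simp
    have "shift n (n - p) p = 0"
      using p by (simp add: shift_def)
    then have "0 \<in> S" unfolding S_def using p by force
    have "card S = 3"
      unfolding S_def using T(2) by (subst card_image) (auto intro: inj_on_subset[OF inj_shift])
    then have "card (S - {0}) = 2"
      using \<open>0 \<in> S\<close> by simp
    then obtain x y where "S - {0} = {x, y}" "x \<noteq> y"
      by (auto simp: card_2_iff)
    \<comment> \<open>Ordering the two points matches \<open>count\<close>, which speaks only of a <
      c; here c may be the fixed point n.\<close>
    then obtain a c where ac: "S - {0} = {a, c}" "a < c"
      by (cases x y rule: linorder_cases) (auto simp: insert_commute)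
    have "a \<in> S - {0}" "c \<in> S"
      using ac by blast+
    then have "0 < a" "c \<le> n"
      using T(1) by (auto simp: S_def intro: shift_le)
    have "S = {0, a, c}"
      using insert_Diff[OF \<open>0 \<in> S\<close>] by (simp only: ac)
    have "card {X \<in> ?A. T \<subseteq> X} = card {X \<in> ?A. S \<subseteq> X}"
      unfolding S_def by (simp add: card_development_containing_shift)
    also have "{X \<in> ?A. S \<subseteq> X} = {X \<in> {X \<in> ?A. 0 \<in> X}. a \<in> X \<and> c \<in> X}"
      by (auto simp: \<open>S = {0, a, c}\<close>)
    \<comment> \<open>By \<open>dist\<close> no block is listed twice, so the cardinality equals the
      length of the filtered list.\<close>
    also have "\<dots> = set (filter (\<lambda>X. a \<in> X \<and> c \<in> X) (map set (blocks_through_zero n D)))"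
      by (simp only: development_containing_zero[OF \<open>0 < n\<close>] set_filter)
    also have "card \<dots> = l"
      using count[OF \<open>0 < a\<close> \<open>a < c\<close> \<open>c \<le> n\<close>]
      by (subst distinct_card[OF distinct_filter[OF dist]]) (simp add: filter_map comp_def)
    finally show ?thesis .
  qed
  show ?thesis
    unfolding t_design_def
    using blocks triple finite_development[of n D]
    by (auto simp: filter_mset_mset_set)
qed

section \<open>An executable form of the criterion\<close>

text \<open>The conditions of the previous lemma are evaluated by rewriting. Comparing the blocks by
  numerical codes reduces their distinctness to sorting, and the recursion over pairs of points
  selects the blocks through a given point only once.\<close>

definition block_code :: "nat list \<Rightarrow> nat" where
  "block_code q = sum_list (map ((^) 2) q)"

primrec points_covered :: "nat \<Rightarrow> nat list list \<Rightarrow> nat list \<Rightarrow> bool" where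
  "points_covered l Q [] = True"
| "points_covered l Q (c # cs) =
     (length (filter (\<lambda>q. c \<in> set q) Q) = l \<and> points_covered l Q cs)"

primrec pairs_covered :: "nat \<Rightarrow> nat list list \<Rightarrow> nat list \<Rightarrow> bool" where
  "pairs_covered l Q [] = True"
| "pairs_covered l Q (a # as) =
     (points_covered l (filter (\<lambda>q. a \<in> set q) Q) as \<and> pairs_covered l Q as)"

lemma points_covered_iff:
  "points_covered l Q cs \<longleftrightarrow> (\<forall>c\<in>set cs. length (filter (\<lambda>q. c \<in> set q) Q) = l)"
  by (induction cs) auto

lemma pairs_covered_iff:
  "pairs_covered l Q as \<longleftrightarrow>
     sorted_wrt (\<lambda>a c. length (filter (\<lambda>q. a \<in> set q \<and> c \<in> set q) Q) = l) as"
  by (induction as) (simp_all add: points_covered_iff conj_commute)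

lemma pairs_covered_uptD:
  assumes "pairs_covered l Q [i..<j]" "i \<le> a" "a < c" "c < j"
  shows "length (filter (\<lambda>q. a \<in> set q \<and> c \<in> set q) Q) = l"
proof -
  have "sorted_wrt (\<lambda>a c. length (filter (\<lambda>q. a \<in> set q \<and> c \<in> set q) Q) = l) [i..<j]"
    using assms(1) by (simp only: pairs_covered_iff)
  \<comment> \<open>The point a stands at position \<open>a - i\<close> of
    \<open>[i..<j]\<close>.\<close>
  from sorted_wrt_nth_less[OF this, of "a - i" "c - i"] show ?thesis
    using assms(2-4) by simp
qed

text \<open>On a list without repetitions the code is the bit mask \<open>set_encode\<close> of its
  set, and a repeated set would repeat its code.\<close>

lemma distinct_map_set_if_distinct_codes:
  assumes "\<And>q. q \<in> set Q \<Longrightarrow> distinct q"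
    and "distinct (map block_code Q)"
  shows "distinct (map set Q)"
proof -
  have "map block_code Q = map set_encode (map set Q)"
    using assms(1) by (auto simp: block_code_def set_encode_def sum_list_distinct_conv_sum_set)
  with assms(2) have "distinct (map set_encode (map set Q))"
    by (simp only:)
  then show ?thesis
    by (rule distinct_map[THEN iffD1, THEN conjunct1])
qed

text \<open>After sorting, only neighbouring codes have to be compared: strict increase from each to
  the next excludes repetitions. The range \<open>[1..<Suc n]\<close> includes the fixed point
  n.\<close>

lemma t_design_development_eval:
  assumes base: "list_all (\<lambda>b. distinct b \<and> length b = k \<and> list_all (\<lambda>x. x \<le> n) b) D"
    and codes: "successively (<) (sort (map block_code (blocks_through_zero n D)))"
    and cover: "pairs_covered l (blocks_through_zero n D) [1..<Suc n]"
  shows "t_design 3 (Suc n) k l {..n} (mset_set (development n D))"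
proof (rule t_design_development)
  show D: "distinct b \<and> length b = k \<and> set b \<subseteq> {..n}" if "b \<in> set D" for b
    using base that by (auto simp: list_all_iff)
  have "distinct q" if "q \<in> set (blocks_through_zero n D)" for q
    using that D inj_on_subset[OF inj_shift[OF diff_le_self] subset_UNIV]
    by (auto simp: blocks_through_zero_def distinct_map)
  moreover have "sorted_wrt (<) (sort (map block_code (blocks_through_zero n D)))"
    using codes by (simp only: successively_conv_sorted_wrt[OF transp_on_less])
  then have "distinct (map block_code (blocks_through_zero n D))"
    by (simp only: strict_sorted_iff distinct_sort)
  ultimately show "distinct (map set (blocks_through_zero n D))"
    by (rule distinct_map_set_if_distinct_codes)
  show "length (filter (\<lambda>q. a \<in> set q \<and> c \<in> set q) (blocks_through_zero n D)) = l"
    if "0 < a" "a < c" "c \<le> n" for a c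
    using pairs_covered_uptD[OF cover] that by simp
qed

lemma simple_blocks_mset_set: "simple_blocks (mset_set A)"
  by (cases "finite A") (simp_all add: simple_blocks_def count_mset_set')

section \<open>The two explicit designs\<close>

text \<open>A 3-(20,5,4) design has 4 * 1140 / 10 = 456 = 24 * 19 blocks, hence 24 base blocks with
  19 translates each.\<close>

definition base_blocks_4 :: "nat list list" where
  "base_blocks_4 =
    [[0, 1, 2, 5, 15], [0, 1, 2, 6, 16], [0, 1, 2, 9, 11], [0, 1, 2, 10, 12], [0, 1, 3, 5, 6],
     [0, 1, 3, 5, 16], [0, 1, 3, 8, 19], [0, 1, 3, 9, 14], [0, 1, 4, 12, 13], [0, 1, 4, 13, 19],
     [0, 1, 4, 15, 17], [0, 1, 6, 10, 14], [0, 1, 6, 11, 17], [0, 1, 7, 8, 16], [0, 1, 7, 10, 13],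
     [0, 1, 7, 16, 19], [0, 1, 12, 17, 19], [0, 2, 4, 7, 16], [0, 2, 6, 9, 13], [0, 2, 6, 11, 19],
     [0, 2, 7, 9, 14], [0, 2, 8, 12, 15], [0, 2, 10, 15, 19], [0, 3, 7, 11, 14]]"

text \<open>Here the block count is 14 * 1140 / 10 = 1596 = 84 * 19, hence 84 base blocks.\<close>

definition base_blocks_14 :: "nat list list" where
  "base_blocks_14 =
    [[0, 1, 2, 3, 4], [0, 1, 2, 3, 9], [0, 1, 2, 3, 13], [0, 1, 2, 5, 12], [0, 1, 2, 6, 8],
     [0, 1, 2, 6, 9], [0, 1, 2, 7, 14], [0, 1, 2, 9, 16], [0, 1, 2, 12, 15], [0, 1, 2, 13, 15],
     [0, 1, 3, 4, 11], [0, 1, 3, 4, 12], [0, 1, 3, 4, 19], [0, 1, 3, 6, 12], [0, 1, 3, 6, 14],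
     [0, 1, 3, 9, 11], [0, 1, 3, 10, 11], [0, 1, 3, 12, 14], [0, 1, 3, 13, 15], [0, 1, 3, 17, 19],
     [0, 1, 4, 5, 11], [0, 1, 4, 5, 12], [0, 1, 4, 5, 13], [0, 1, 4, 6, 8], [0, 1, 4, 7, 8],
     [0, 1, 4, 7, 10], [0, 1, 4, 9, 19], [0, 1, 4, 11, 19], [0, 1, 4, 16, 19], [0, 1, 5, 6, 12],
     [0, 1, 5, 6, 13], [0, 1, 5, 7, 17], [0, 1, 5, 9, 10], [0, 1, 5, 9, 14], [0, 1, 5, 10, 13],
     [0, 1, 5, 10, 15], [0, 1, 5, 13, 19], [0, 1, 6, 7, 13], [0, 1, 6, 8, 17], [0, 1, 6, 9, 13],
     [0, 1, 6, 10, 19], [0, 1, 6, 11, 15], [0, 1, 6, 14, 17], [0, 1, 7, 8, 19], [0, 1, 7, 10, 15],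
     [0, 1, 7, 11, 14], [0, 1, 7, 15, 19], [0, 1, 8, 10, 11], [0, 1, 8, 10, 12], [0, 1, 8, 14, 17],
     [0, 1, 9, 11, 17], [0, 1, 9, 16, 19], [0, 1, 10, 13, 16], [0, 1, 10, 14, 19], [0, 1, 11, 16, 19],
     [0, 1, 12, 14, 16], [0, 2, 4, 6, 9], [0, 2, 4, 6, 16], [0, 2, 4, 7, 10], [0, 2, 4, 7, 15],
     [0, 2, 4, 7, 16], [0, 2, 4, 8, 16], [0, 2, 4, 9, 14], [0, 2, 4, 13, 16], [0, 2, 5, 8, 10],
     [0, 2, 5, 9, 16], [0, 2, 5, 11, 15], [0, 2, 5, 12, 16], [0, 2, 5, 16, 19], [0, 2, 6, 8, 19],
     [0, 2, 6, 9, 15], [0, 2, 6, 10, 14], [0, 2, 6, 10, 16], [0, 2, 6, 12, 15], [0, 2, 6, 15, 19],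
     [0, 2, 7, 9, 19], [0, 2, 7, 11, 15], [0, 2, 7, 13, 19], [0, 2, 8, 14, 19], [0, 2, 9, 11, 19],
     [0, 2, 9, 12, 19], [0, 3, 6, 10, 15], [0, 3, 6, 11, 14], [0, 3, 8, 14, 19]]"

lemma t_design_4: "t_design 3 20 5 4 {..19} (mset_set (development 19 base_blocks_4))"
proof -
  have "t_design 3 (Suc 19) 5 4 {..19} (mset_set (development 19 base_blocks_4))"
  proof (rule t_design_development_eval)
    show "list_all (\<lambda>b. distinct b \<and> length b = 5 \<and> list_all (\<lambda>x. x \<le> 19) b) base_blocks_4"
      by code_simp
    show "successively (<) (sort (map block_code (blocks_through_zero 19 base_blocks_4)))"
      by code_simp
    show "pairs_covered 4 (blocks_through_zero 19 base_blocks_4) [1..<Suc 19]"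
      by code_simp
  qed
  then show ?thesis
    by simp
qed

lemma t_design_14: "t_design 3 20 5 14 {..19} (mset_set (development 19 base_blocks_14))"
proof -
  have "t_design 3 (Suc 19) 5 14 {..19} (mset_set (development 19 base_blocks_14))"
  proof (rule t_design_development_eval)
    show "list_all (\<lambda>b. distinct b \<and> length b = 5 \<and> list_all (\<lambda>x. x \<le> 19) b) base_blocks_14"
      by code_simp
    show "successively (<) (sort (map block_code (blocks_through_zero 19 base_blocks_14)))"
      by code_simp
    show "pairs_covered 14 (blocks_through_zero 19 base_blocks_14) [1..<Suc 19]"
      by code_simp
  qed
  then show ?thesis
    by simp
qed

theorem theorem3:
  "\<forall>m \<in> {2, 7 :: nat}. \<exists>(P :: nat set) B. t_design 3 20 5 (2 * m) P B \<and> simple_blocks B"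
proof
  fix m :: nat
  assume "m \<in> {2, 7}"
  then have "2 * m = 4 \<or> 2 * m = 14"
    by auto
  then show "\<exists>(P :: nat set) B. t_design 3 20 5 (2 * m) P B \<and> simple_blocks B"
    using t_design_4 t_design_14 simple_blocks_mset_set by metis
qed

end
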